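(* Let $f : \mathbb{R}^2 \to \mathbb{R}$ be a function satisfying the functional equation $$f(x_1, y_1)\, f(x_2, y_2) = f(x_1 x_2 + y_1 y_2,\; x_1 y_2 - y_1 x_2)$$ for all $x_1, x_2, y_1, y_2 \in \mathbb{R}$. Then there exist a multiplicative function $m : \mathbb{R} \to \mathbb{R}$ and a function $\sigma : \mathbb{R}^2 \to \{-1, +1\}$ such that $$f(x, y) = \sigma(x, y)\, m\left(\sqrt{x^2 + y^2}\right)$$ for all real numbers $x$ and $y$.
   Context: A function $m : \mathbb{R} \to \mathbb{R}$ is called multiplicative if $m(xy) = m(x)m(y)$ for all $x, y \in \mathbb{R}$. The function $\sigma$ (called a signum function) is an arbitrary function with values in $\{-1,+1\}$. *)

theory Defs
  imports Complex_Main
begin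

definition multiplicative :: "(real \<Rightarrow> real) \<Rightarrow> bool" where
  "multiplicative m \<longleftrightarrow> (\<forall>x y. m (x * y) = m x * m y)"

definition signum_function :: "('a \<Rightarrow> real) \<Rightarrow> bool" where
  "signum_function \<sigma> \<longleftrightarrow> range \<sigma> \<subseteq> {-1, 1}"

end

theory Submission
  imports Defs
begin

text \<open>
  Identify \<open>(x, y)\<close> with the complex number \<open>z = x + i y\<close>. The argument on the right-hand side is then the
  product of the conjugate of \<open>z\<^sub>1\<close> with \<open>z\<^sub>2\<close>. On the real axis conjugation is trivial, so the
  restriction \<open>m t = f (t, 0)\<close> is multiplicative. Taking \<open>z\<^sub>1 = z\<^sub>2 = z\<close> shows that \<open>f(z)\<^sup>2\<close> is the
  value of \<open>f\<close> at the real number \<open>|z|\<^sup>2\<close>, which is also \<open>f(|z|)\<^sup>2\<close>. Hence \<open>f(z)\<close> and \<open>m(|z|)\<close>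
  agree up to sign, and \<open>\<sigma>\<close> records that sign.
\<close>

theorem theorem1:
  fixes f :: "real \<times> real \<Rightarrow> real"
  assumes "\<And>x1 x2 y1 y2 :: real.
    f (x1, y1) * f (x2, y2) = f (x1 * x2 + y1 * y2, x1 * y2 - y1 * x2)"
  shows "\<exists>(m :: real \<Rightarrow> real) (\<sigma> :: real \<times> real \<Rightarrow> real).
    multiplicative m \<and> signum_function \<sigma> \<and>
    (\<forall>x y. f (x, y) = \<sigma> (x, y) * m (sqrt (x\<^sup>2 + y\<^sup>2)))"
proof -
  define m where "m t = f (t, 0)" for t
  define \<sigma> :: "real \<times> real \<Rightarrow> real"
    where "\<sigma> = (\<lambda>(x, y). if f (x, y) = m (sqrt (x\<^sup>2 + y\<^sup>2)) then 1 else -1)"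
  have m_mult: "m (s * t) = m s * m t" for s t
    using assms[of s 0 t 0] by (simp add: m_def)
  have "(f (x, y))\<^sup>2 = (m (sqrt (x\<^sup>2 + y\<^sup>2)))\<^sup>2" for x y
  proof -
    have "(f (x, y))\<^sup>2 = m (x\<^sup>2 + y\<^sup>2)"
      using assms[of x y x y] by (simp add: m_def power2_eq_square mult.commute)
    also have "\<dots> = (m (sqrt (x\<^sup>2 + y\<^sup>2)))\<^sup>2"
      using m_mult[of "sqrt (x\<^sup>2 + y\<^sup>2)" "sqrt (x\<^sup>2 + y\<^sup>2)"]
      by (simp add: power2_eq_square)
    finally show ?thesis .
  qed
  then have "f (x, y) = \<sigma> (x, y) * m (sqrt (x\<^sup>2 + y\<^sup>2))" for x y
    by (auto simp: \<sigma>_def power2_eq_iff)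
  moreover have "multiplicative m"
    by (simp add: multiplicative_def m_mult)
  moreover have "signum_function \<sigma>"
    by (auto simp: signum_function_def \<sigma>_def split: if_splits)
  ultimately show ?thesis
    by blast
qed

end
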